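(* Let $K$ be a field, let $n\geq 1$, and let $\phi$ be a ring anti-automorphism of $\mathrm{M}_n(K)$. Then there is a field automorphism $f$ of $K$ such that the following holds. The kernel of $I_n-(\phi(S^{\top}))^{n-1}\phi(E_{1,n})\in\mathrm{M}_n(K)$ contains a nonzero vector, and for every nonzero vector $\mathbf{a}\in K^n$ in this kernel, the matrix $$\overline{A}=\left[(\phi(S^{\top}))^{n-1}\phi(E_{1,n})\mathbf{a}\mid(\phi(S^{\top}))^{n-2}\phi(E_{1,n})\mathbf{a}\mid\cdots\mid\phi(S^{\top})\phi(E_{1,n})\mathbf{a}\mid\phi(E_{1,n})\mathbf{a}\right]\in\mathrm{M}_n(K)$$ is invertible and $$\phi(X)=\overline{A}X_f^{\top}\overline{A}^{-1}$$ for all $X\in\mathrm{M}_n(K)$.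
   Context: A ring anti-automorphism of $\mathrm{M}_n(K)$ is a bijective additive map $\phi:\mathrm{M}_n(K)\to\mathrm{M}_n(K)$ with $\phi(XY)=\phi(Y)\phi(X)$ for all $X,Y$ (not assumed $K$-linear). For $X=[x_{i,j}]\in\mathrm{M}_n(K)$ and a field automorphism $f$ of $K$, $X_f=[f(x_{i,j})]$ is obtained by applying $f$ entrywise; $X^{\top}$ is the transpose of $X$ and $X_f^{\top}=(X_f)^{\top}$. $E_{i,j}$ is the standard matrix unit with $1$ in position $(i,j)$ and zeros elsewhere, $I_n$ is the identity matrix, and $S=E_{1,2}+E_{2,3}+\cdots+E_{n-1,n}$. Vectors are columns, and the bars in $\overline{A}$ separate its $n$ columns: for $1\le k\le n$ the $k$-th column is $(\phi(S^{\top}))^{n-k}\phi(E_{1,n})\mathbf{a}$ (with zeroth powers equal to $I_n$). *)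

theory Defs
  imports "Jordan_Normal_Form.Gauss_Jordan_Elimination" "Jordan_Normal_Form.Matrix_Kernel"
begin

text \<open>As in \<open>Jordan_Normal_Form\<close>, rows and columns are numbered from 0, so that
  the matrix unit usually written \<open>E\<^sub>1\<^sub>,\<^sub>n\<close> is \<open>elem_mat n 0 (n - 1)\<close>.\<close>

definition elem_mat :: "nat \<Rightarrow> nat \<Rightarrow> nat \<Rightarrow> 'a::field mat" where
  "elem_mat n i j = mat n n (\<lambda>(r, c). if r = i \<and> c = j then 1 else 0)"

text \<open>The sum of the matrix units \<open>elem_mat n i (Suc i)\<close> for \<open>Suc i < n\<close>.\<close>

definition shift_mat :: "nat \<Rightarrow> 'a::field mat" where
  "shift_mat n = mat n n (\<lambda>(r, c). if c = Suc r then 1 else 0)"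

text \<open>No linearity over the field is required. Values outside the carrier are unconstrained.\<close>

definition ring_anti_automorphism :: "nat \<Rightarrow> ('a::field mat \<Rightarrow> 'a mat) \<Rightarrow> bool" where
  "ring_anti_automorphism n \<phi> \<longleftrightarrow>
     bij_betw \<phi> (carrier_mat n n) (carrier_mat n n) \<and>
     (\<forall>X \<in> carrier_mat n n. \<forall>Y \<in> carrier_mat n n. \<phi> (X + Y) = \<phi> X + \<phi> Y) \<and>
     (\<forall>X \<in> carrier_mat n n. \<forall>Y \<in> carrier_mat n n. \<phi> (X * Y) = \<phi> Y * \<phi> X)"

text \<open>With columns numbered from 0, the exponent for column \<open>k\<close> is \<open>n - Suc k\<close>, running from
  \<open>n - 1\<close> down to \<open>0\<close>.\<close>

definition A_bar :: "nat \<Rightarrow> ('a::field mat \<Rightarrow> 'a mat) \<Rightarrow> 'a vec \<Rightarrow> 'a mat" where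
  "A_bar n \<phi> a = mat_of_cols n
     (map (\<lambda>k. (\<phi> (transpose_mat (shift_mat n)) ^\<^sub>m (n - Suc k) * \<phi> (elem_mat n 0 (n - 1))) *\<^sub>v a)
       [0..<n])"

end

theory Submission
  imports Defs
begin

text \<open>Scalar matrices form the center of the matrix ring, so \<open>\<phi>\<close> maps them to each other and
  thereby induces a field automorphism \<open>f\<close>. With the paper's 1-based indices,
  \<open>E\<^sub>1\<^sub>,\<^sub>n (S\<^sup>T)\<^sup>m = E\<^sub>1\<^sub>,\<^sub>n\<^sub>-\<^sub>m\<close>, hence column \<open>k\<close> of \<open>A_bar n \<phi> a\<close> is \<open>\<phi> E\<^sub>1\<^sub>,\<^sub>k a\<close>, and the
  kernel condition says that \<open>a\<close> is fixed by the nonzero idempotent \<open>\<phi> E\<^sub>1\<^sub>,\<^sub>1\<close>. Let \<open>R w\<close> be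
  the matrix with first row \<open>w\<close> and all other rows zero; then \<open>A_bar n \<phi> a\<close> sends \<open>f w\<close> to
  \<open>\<phi> (R w) a\<close>. From \<open>R w * X = R (X\<^sup>T w)\<close> one obtains
  \<open>\<phi> X * A_bar n \<phi> a = A_bar n \<phi> a * (X\<^sub>f)\<^sup>T\<close>, and from \<open>R w * E\<^sub>k\<^sub>,\<^sub>1 = w\<^sub>k E\<^sub>1\<^sub>,\<^sub>1\<close> that
  \<open>A_bar n \<phi> a\<close> has trivial kernel.\<close>

section \<open>Matrix units and scalar matrices\<close>

lemma elem_mat_carrier [simp]: "elem_mat n i j \<in> carrier_mat n n"
  by (simp add: elem_mat_def)

lemma shift_mat_carrier [simp]: "shift_mat n \<in> carrier_mat n n"
  by (simp add: shift_mat_def)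

lemma elem_mat_mult:
  assumes "M \<in> carrier_mat n n" "j < n"
  shows "elem_mat n i j * M = mat n n (\<lambda>(r, c). if r = i then M $$ (j, c) else 0)"
proof (rule eq_matI)
  fix r c
  assume "r < dim_row (mat n n (\<lambda>(r, c). if r = i then M $$ (j, c) else 0))"
    "c < dim_col (mat n n (\<lambda>(r, c). if r = i then M $$ (j, c) else 0))"
  then have rc: "r < n" "c < n" by auto
  have "(elem_mat n i j * M) $$ (r, c)
      = (\<Sum>k<n. (if r = i \<and> k = j then 1 else 0) * M $$ (k, c))"
    using assms rc by (auto simp: elem_mat_def scalar_prod_def atLeast0LessThan intro!: sum.cong)
  also have "\<dots> = (\<Sum>k<n. if k = j then (if r = i then M $$ (j, c) else 0) else 0)"
    by (rule sum.cong) auto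
  finally show "(elem_mat n i j * M) $$ (r, c)
      = mat n n (\<lambda>(r, c). if r = i then M $$ (j, c) else 0) $$ (r, c)"
    using assms rc by simp
qed (use assms in \<open>auto simp: elem_mat_def\<close>)

lemma mult_elem_mat:
  assumes "M \<in> carrier_mat n n" "i < n"
  shows "M * elem_mat n i j = mat n n (\<lambda>(r, c). if c = j then M $$ (r, i) else 0)"
proof (rule eq_matI)
  fix r c
  assume "r < dim_row (mat n n (\<lambda>(r, c). if c = j then M $$ (r, i) else 0))"
    "c < dim_col (mat n n (\<lambda>(r, c). if c = j then M $$ (r, i) else 0))"
  then have rc: "r < n" "c < n" by auto
  have "(M * elem_mat n i j) $$ (r, c)
      = (\<Sum>k<n. M $$ (r, k) * (if k = i \<and> c = j then 1 else 0))"
    using assms rc by (auto simp: elem_mat_def scalar_prod_def atLeast0LessThan intro!: sum.cong)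
  also have "\<dots> = (\<Sum>k<n. if k = i then (if c = j then M $$ (r, i) else 0) else 0)"
    by (rule sum.cong) auto
  finally show "(M * elem_mat n i j) $$ (r, c)
      = mat n n (\<lambda>(r, c). if c = j then M $$ (r, i) else 0) $$ (r, c)"
    using assms rc by simp
qed (use assms in \<open>auto simp: elem_mat_def\<close>)

text \<open>One family of tests suffices: in the two products with \<open>elem_mat n 0 r\<close>,
  entry \<open>(0, c)\<close> is \<open>M $$ (r, c)\<close> on one side and, on the other,
  \<open>M $$ (0, 0)\<close> if \<open>c = r\<close> and 0 otherwise.\<close>

lemma commuting_imp_scalar_mat:
  fixes M :: "'a::field mat"
  assumes M: "M \<in> carrier_mat n n"
    and comm: "\<And>X. X \<in> carrier_mat n n \<Longrightarrow> M * X = X * M"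
  shows "M = M $$ (0, 0) \<cdot>\<^sub>m 1\<^sub>m n"
proof (rule eq_matI)
  fix r c assume "r < dim_row (M $$ (0, 0) \<cdot>\<^sub>m 1\<^sub>m n)" "c < dim_col (M $$ (0, 0) \<cdot>\<^sub>m 1\<^sub>m n)"
  then have rc: "r < n" "c < n" by auto
  have "(M * elem_mat n 0 r) $$ (0, c) = (elem_mat n 0 r * M) $$ (0, c)"
    using comm by simp
  then show "M $$ (r, c) = (M $$ (0, 0) \<cdot>\<^sub>m 1\<^sub>m n) $$ (r, c)"
    using M rc by (auto simp: elem_mat_mult mult_elem_mat split: if_splits)
qed (use M in auto)

text \<open>Each new factor on the right moves the only 1 one column to the left;
  \<open>m < n\<close> keeps it inside the matrix.\<close>

lemma elem_mat_mult_transpose_shift_power: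
  assumes "m < n"
  shows "elem_mat n 0 (n - 1) * (transpose_mat (shift_mat n) ^\<^sub>m m :: 'a::field mat)
    = elem_mat n 0 (n - Suc m)"
  using assms
proof (induction m)
  case 0
  have "elem_mat n 0 (n - 1) * 1\<^sub>m n = (elem_mat n 0 (n - 1) :: 'a mat)"
    by (rule right_mult_one_mat[of _ n]) simp
  then show ?case by (simp add: shift_mat_def)
next
  case (Suc m)
  let ?T = "transpose_mat (shift_mat n) :: 'a mat"
  have T: "?T \<in> carrier_mat n n" by simp
  have "elem_mat n 0 (n - 1) * (?T ^\<^sub>m Suc m) = elem_mat n 0 (n - 1) * ?T ^\<^sub>m m * ?T"
    using T by (auto simp: assoc_mult_mat[of _ n n _ n _ n] pow_carrier_mat)
  also have "\<dots> = elem_mat n 0 (n - Suc m) * ?T"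
    using Suc by simp
  also have "\<dots> = elem_mat n 0 (n - Suc (Suc m))"
  proof -
    have j: "n - Suc m < n" using Suc.prems by simp
    show ?thesis
      unfolding elem_mat_mult[OF T j] using Suc.prems
      by (intro eq_matI) (auto simp: shift_mat_def elem_mat_def)
  qed
  finally show ?case .
qed

section \<open>Vectors, powers and inverses of matrices\<close>

lemma minus_vec_eq_0_iff:
  fixes v w :: "'a::group_add vec"
  assumes "v \<in> carrier_vec n" "w \<in> carrier_vec n"
  shows "v - w = 0\<^sub>v n \<longleftrightarrow> v = w"
proof
  assume "v - w = 0\<^sub>v n"
  then have "(v - w) $ i = 0" if "i < n" for i using that by simp
  then show "v = w" using assms by (intro eq_vecI) auto
qed (use assms in \<open>auto intro: eq_vecI\<close>)

lemma smult_mat_mult_vec: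
  assumes "M \<in> carrier_mat nr nc" "v \<in> carrier_vec nc"
  shows "(c \<cdot>\<^sub>m M) *\<^sub>v v = c \<cdot>\<^sub>v (M *\<^sub>v v)"
  using assms by (intro eq_vecI) (auto simp: scalar_prod_def sum_distrib_left mult.assoc)

lemma mat_eqI_mult_vec:
  fixes A B :: "'a::field mat"
  assumes A: "A \<in> carrier_mat nr nc" and B: "B \<in> carrier_mat nr nc"
    and eq: "\<And>v. v \<in> carrier_vec nc \<Longrightarrow> A *\<^sub>v v = B *\<^sub>v v"
  shows "A = B"
proof (rule eq_matI)
  fix i j assume "i < dim_row B" "j < dim_col B"
  then show "A $$ (i, j) = B $$ (i, j)"
    using A B arg_cong[OF eq[OF unit_vec_carrier[of nc j]], of "\<lambda>v. v $ i"] by auto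
qed (use A B in auto)

text \<open>Powers are defined with the new factor on the right, and an anti-automorphism moves that
  factor to the left.\<close>

lemma pow_mat_Suc_left:
  assumes "M \<in> carrier_mat n n"
  shows "M ^\<^sub>m Suc k = M * M ^\<^sub>m k"
proof (induction k)
  case 0
  show ?case using assms by simp
next
  case (Suc k)
  have "M ^\<^sub>m Suc (Suc k) = M * M ^\<^sub>m k * M"
    using Suc by simp
  also have "\<dots> = M * M ^\<^sub>m Suc k"
    using assms by (simp add: assoc_mult_mat[of _ n n _ n _ n])
  finally show ?case .
qed

lemma smult_smult_mat: "a \<cdot>\<^sub>m (b \<cdot>\<^sub>m M) = (a * b) \<cdot>\<^sub>m (M :: 'a::field mat)"
  by (intro eq_matI) (auto simp: mult.assoc)

text \<open>A trivial kernel gives a nonzero determinant, hence a unit of the matrix ring, which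
  excludes the result \<open>None\<close>.\<close>

lemma trivial_kernel_imp_mat_inverse:
  fixes A :: "'a::field mat"
  assumes A: "A \<in> carrier_mat n n"
    and ker: "\<And>v. v \<in> carrier_vec n \<Longrightarrow> A *\<^sub>v v = 0\<^sub>v n \<Longrightarrow> v = 0\<^sub>v n"
  obtains B where "mat_inverse A = Some B" "B \<in> carrier_mat n n" "A * B = 1\<^sub>m n" "B * A = 1\<^sub>m n"
proof -
  have "det A \<noteq> 0"
    using ker by (auto simp: det_0_iff_vec_prod_zero_field[OF A])
  \<comment> \<open>\<open>b\<close> fills the free extra field of the record
    \<open>ring_mat\<close>; both facts must speak of the same record.\<close>
  then have "mat_inverse A \<noteq> None"
    using det_non_zero_imp_unit[OF A, where b = "()"] mat_inverse(1)[OF A, where b = "()"] by blast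
  then show thesis
    using mat_inverse(2)[OF A] that by blast
qed

section \<open>Ring laws of an anti-automorphism\<close>

context
  fixes n :: nat and \<phi> :: "'a::field mat \<Rightarrow> 'a mat"
  assumes n: "0 < n" and anti: "ring_anti_automorphism n \<phi>"
begin

lemma phi_bij: "bij_betw \<phi> (carrier_mat n n) (carrier_mat n n)"
  using anti by (simp add: ring_anti_automorphism_def)

lemma phi_carrier [simp]: "X \<in> carrier_mat n n \<Longrightarrow> \<phi> X \<in> carrier_mat n n"
  using phi_bij by (rule bij_betw_apply)

lemma phi_dim [simp]:
  assumes "X \<in> carrier_mat n n"
  shows "dim_row (\<phi> X) = n" "dim_col (\<phi> X) = n"
  using phi_carrier[OF assms] by auto

lemma phi_surj:
  assumes "Y \<in> carrier_mat n n"
  obtains X where "X \<in> carrier_mat n n" "\<phi> X = Y"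
proof -
  have "Y \<in> \<phi> ` carrier_mat n n"
    using assms bij_betw_imp_surj_on[OF phi_bij] by simp
  then show thesis by (auto intro: that)
qed

lemma phi_inj: "X \<in> carrier_mat n n \<Longrightarrow> Y \<in> carrier_mat n n \<Longrightarrow> \<phi> X = \<phi> Y \<Longrightarrow> X = Y"
  by (rule inj_onD[OF bij_betw_imp_inj_on[OF phi_bij]])

lemma phi_add: "X \<in> carrier_mat n n \<Longrightarrow> Y \<in> carrier_mat n n \<Longrightarrow> \<phi> (X + Y) = \<phi> X + \<phi> Y"
  using anti by (simp add: ring_anti_automorphism_def)

lemma phi_mult: "X \<in> carrier_mat n n \<Longrightarrow> Y \<in> carrier_mat n n \<Longrightarrow> \<phi> (X * Y) = \<phi> Y * \<phi> X"
  using anti by (simp add: ring_anti_automorphism_def)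

lemma phi_zero: "\<phi> (0\<^sub>m n n) = 0\<^sub>m n n"
proof -
  let ?Z = "\<phi> (0\<^sub>m n n)"
  have "?Z + ?Z = ?Z"
    using phi_add[of "0\<^sub>m n n" "0\<^sub>m n n"] by simp
  then have eq: "(?Z + ?Z) $$ (i, j) = ?Z $$ (i, j)" for i j by (rule arg_cong)
  have "?Z $$ (i, j) = 0" if "i < n" "j < n" for i j
    using eq[of i j] that by (simp only: index_add_mat phi_dim zero_carrier_mat add_cancel_left_right)
  then show ?thesis
    by (intro eq_matI) auto
qed

text \<open>Surjectivity supplies an \<open>X\<close> with \<open>\<phi> X = 1\<^sub>m n\<close>;
  then \<open>\<phi> (X * 1\<^sub>m n)\<close> equals both \<open>1\<^sub>m n\<close> and
  \<open>\<phi> (1\<^sub>m n)\<close>.\<close>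

lemma phi_one: "\<phi> (1\<^sub>m n) = 1\<^sub>m n"
proof -
  obtain X where X: "X \<in> carrier_mat n n" "\<phi> X = 1\<^sub>m n"
    using phi_surj[of "1\<^sub>m n"] by auto
  have "\<phi> (X * 1\<^sub>m n) = \<phi> (1\<^sub>m n) * \<phi> X"
    using X by (intro phi_mult) auto
  moreover have "\<phi> (1\<^sub>m n) \<in> carrier_mat n n" by simp
  ultimately show ?thesis
    using X by simp
qed

lemma phi_pow: "X \<in> carrier_mat n n \<Longrightarrow> \<phi> (X ^\<^sub>m m) = \<phi> X ^\<^sub>m m"
proof (induction m)
  case 0
  then have "dim_row X = n" by auto
  with 0 show ?case
    by (simp add: phi_one)
next
  case (Suc m)
  have c: "\<phi> X \<in> carrier_mat n n" using Suc.prems by simp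
  have "\<phi> (X ^\<^sub>m Suc m) = \<phi> X * \<phi> X ^\<^sub>m m"
    using Suc by (simp add: phi_mult pow_carrier_mat)
  then show ?case
    by (simp only: pow_mat_Suc_left[OF c])
qed

section \<open>The automorphism of the field induced on the center\<close>

definition induced_hom :: "'a \<Rightarrow> 'a" where
  "induced_hom c = \<phi> (c \<cdot>\<^sub>m 1\<^sub>m n) $$ (0, 0)"

text \<open>Since \<open>\<phi>\<close> is onto, the image of a central matrix commutes with every
  matrix and is therefore scalar. This justifies reading off only the entry \<open>(0, 0)\<close> in
  \<open>induced_hom\<close>.\<close>

lemma phi_scalar_mat: "\<phi> (c \<cdot>\<^sub>m 1\<^sub>m n) = induced_hom c \<cdot>\<^sub>m 1\<^sub>m n"
  unfolding induced_hom_def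
proof (rule commuting_imp_scalar_mat)
  fix Y :: "'a mat" assume "Y \<in> carrier_mat n n"
  then obtain X where X: "X \<in> carrier_mat n n" "\<phi> X = Y" by (rule phi_surj)
  have "X * (c \<cdot>\<^sub>m 1\<^sub>m n) = c \<cdot>\<^sub>m 1\<^sub>m n * X"
    using X by (simp add: mult_smult_distrib[of _ n n _ n] mult_smult_assoc_mat[of _ n n _ n])
  then show "\<phi> (c \<cdot>\<^sub>m 1\<^sub>m n) * Y = Y * \<phi> (c \<cdot>\<^sub>m 1\<^sub>m n)"
    using X phi_mult[of X "c \<cdot>\<^sub>m 1\<^sub>m n"] phi_mult[of "c \<cdot>\<^sub>m 1\<^sub>m n" X] by simp
qed simp

lemma scalar_mat_eq_iff: "a \<cdot>\<^sub>m 1\<^sub>m n = b \<cdot>\<^sub>m (1\<^sub>m n :: 'a mat) \<longleftrightarrow> a = b"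
proof
  assume "a \<cdot>\<^sub>m 1\<^sub>m n = b \<cdot>\<^sub>m (1\<^sub>m n :: 'a mat)"
  then have "(a \<cdot>\<^sub>m 1\<^sub>m n) $$ (0, 0) = (b \<cdot>\<^sub>m (1\<^sub>m n :: 'a mat)) $$ (0, 0)" by simp
  then show "a = b" using n by simp
qed simp

lemma phi_smult:
  assumes "X \<in> carrier_mat n n"
  shows "\<phi> (c \<cdot>\<^sub>m X) = induced_hom c \<cdot>\<^sub>m \<phi> X"
proof -
  \<comment> \<open>The scalar matrix is placed on the right so that the reversal brings it to the
    left.\<close>
  have "c \<cdot>\<^sub>m X = X * (c \<cdot>\<^sub>m 1\<^sub>m n)"
    using assms by (simp add: mult_smult_distrib[of _ n n _ n])
  then have "\<phi> (c \<cdot>\<^sub>m X) = (induced_hom c \<cdot>\<^sub>m 1\<^sub>m n) * \<phi> X"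
    using assms by (simp add: phi_mult phi_scalar_mat)
  then show ?thesis
    using assms phi_carrier[OF assms] by (simp add: mult_smult_assoc_mat[of _ n n _ n])
qed

lemma field_isom_induced_hom: "field_isom induced_hom"
proof
  show "induced_hom 0 = 0"
  proof -
    have "0 \<cdot>\<^sub>m 1\<^sub>m n = (0\<^sub>m n n :: 'a mat)" by (intro eq_matI) auto
    then show ?thesis using n by (simp add: induced_hom_def phi_zero)
  qed
  show "induced_hom 1 = 1"
  proof -
    have "1 \<cdot>\<^sub>m 1\<^sub>m n = (1\<^sub>m n :: 'a mat)" by (intro eq_matI) auto
    then show ?thesis using n by (simp add: induced_hom_def phi_one)
  qed
  fix x y :: 'a
  have "\<phi> ((x + y) \<cdot>\<^sub>m 1\<^sub>m n) = \<phi> (x \<cdot>\<^sub>m 1\<^sub>m n) + \<phi> (y \<cdot>\<^sub>m 1\<^sub>m n)"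
    by (subst phi_add[symmetric]) (auto simp: add_smult_distrib_right_mat[of _ n n])
  then show "induced_hom (x + y) = induced_hom x + induced_hom y"
    using n by (simp add: phi_scalar_mat scalar_mat_eq_iff
        add_smult_distrib_right_mat[of _ n n, symmetric])
  have "\<phi> ((x * y) \<cdot>\<^sub>m 1\<^sub>m n) = induced_hom x \<cdot>\<^sub>m \<phi> (y \<cdot>\<^sub>m 1\<^sub>m n)"
    by (subst phi_smult[symmetric]) (auto intro!: arg_cong[of _ _ \<phi>])
  then have "induced_hom (x * y) \<cdot>\<^sub>m 1\<^sub>m n = (induced_hom x * induced_hom y) \<cdot>\<^sub>m (1\<^sub>m n :: 'a mat)"
    by (simp add: phi_scalar_mat smult_smult_mat)
  then show "induced_hom (x * y) = induced_hom x * induced_hom y"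
    by (simp add: scalar_mat_eq_iff)
next
  \<comment> \<open>Injectivity is automatic for a homomorphism of fields. For surjectivity, the
    preimage \<open>Y\<close> of a scalar matrix is central, because injectivity of
    \<open>\<phi>\<close> pulls the commutation back; hence \<open>Y\<close> is scalar too.\<close>
  show "surj induced_hom"
    unfolding surj_def
  proof
    fix d :: 'a
    obtain Y where Y: "Y \<in> carrier_mat n n" "\<phi> Y = d \<cdot>\<^sub>m 1\<^sub>m n"
      by (rule phi_surj[of "d \<cdot>\<^sub>m 1\<^sub>m n"]) auto
    have "Y * X = X * Y" if X: "X \<in> carrier_mat n n" for X
    proof (rule phi_inj)
      show "\<phi> (Y * X) = \<phi> (X * Y)"
        using phi_carrier[OF X] unfolding phi_mult[OF X Y(1)] phi_mult[OF Y(1) X] Y(2)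
        by (simp add: mult_smult_distrib[of _ n n _ n] mult_smult_assoc_mat[of _ n n _ n])
    qed (use X Y(1) in auto)
    then obtain c where "Y = c \<cdot>\<^sub>m 1\<^sub>m n"
      using commuting_imp_scalar_mat[OF Y(1)] by blast
    then have "d \<cdot>\<^sub>m 1\<^sub>m n = induced_hom c \<cdot>\<^sub>m 1\<^sub>m n"
      using Y(2) by (simp add: phi_scalar_mat)
    then show "\<exists>c. d = induced_hom c"
      by (auto simp: scalar_mat_eq_iff)
  qed
qed

section \<open>The kernel condition as a fixed-point condition\<close>

lemma phi_shift_power_mult_phi_elem:
  assumes "m < n"
  shows "\<phi> (transpose_mat (shift_mat n)) ^\<^sub>m m * \<phi> (elem_mat n 0 (n - 1))
    = \<phi> (elem_mat n 0 (n - Suc m))"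
proof -
  let ?T = "transpose_mat (shift_mat n) :: 'a mat"
  have T: "?T \<in> carrier_mat n n" by simp
  have "\<phi> ?T ^\<^sub>m m * \<phi> (elem_mat n 0 (n - 1)) = \<phi> (elem_mat n 0 (n - 1) * ?T ^\<^sub>m m)"
    using phi_mult[OF elem_mat_carrier pow_carrier_mat[OF T]] phi_pow[OF T] by metis
  also have "elem_mat n 0 (n - 1) * ?T ^\<^sub>m m = elem_mat n 0 (n - Suc m)"
    by (rule elem_mat_mult_transpose_shift_power[OF assms])
  finally show ?thesis .
qed

lemma kernel_iff_fixed:
  "a \<in> mat_kernel (1\<^sub>m n - \<phi> (transpose_mat (shift_mat n)) ^\<^sub>m (n - 1) * \<phi> (elem_mat n 0 (n - 1)))
    \<longleftrightarrow> a \<in> carrier_vec n \<and> \<phi> (elem_mat n 0 0) *\<^sub>v a = a"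
proof -
  let ?P = "\<phi> (elem_mat n 0 0)"
  have P: "?P \<in> carrier_mat n n" by simp
  have *: "(1\<^sub>m n - ?P) *\<^sub>v a = a - ?P *\<^sub>v a" if "a \<in> carrier_vec n"
    using that P by (simp add: minus_mult_distrib_mat_vec[of _ n n])
  have **: "a - ?P *\<^sub>v a = 0\<^sub>v n \<longleftrightarrow> a = ?P *\<^sub>v a" if "a \<in> carrier_vec n"
    by (rule minus_vec_eq_0_iff[OF that mult_mat_vec_carrier[OF P that]])
  \<comment> \<open>Since \<open>0 < n\<close>, the index \<open>n - Suc (n - 1)\<close> is
    0.\<close>
  have Q: "\<phi> (transpose_mat (shift_mat n)) ^\<^sub>m (n - 1) * \<phi> (elem_mat n 0 (n - 1)) = ?P"
    using n phi_shift_power_mult_phi_elem[of "n - 1"] by simp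
  have "(1\<^sub>m n - ?P) *\<^sub>v a = 0\<^sub>v n \<longleftrightarrow> ?P *\<^sub>v a = a" if "a \<in> carrier_vec n"
    unfolding *[OF that] **[OF that] by (rule eq_commute)
  then show ?thesis
    unfolding Q mat_kernel[OF minus_carrier_mat[OF P]] mem_Collect_eq by (rule conj_cong[OF refl])
qed

lemma phi_elem_idem: "\<phi> (elem_mat n 0 0) * \<phi> (elem_mat n 0 0) = \<phi> (elem_mat n 0 0)"
proof -
  have "elem_mat n 0 0 * elem_mat n 0 0 = (elem_mat n 0 0 :: 'a mat)"
    unfolding elem_mat_mult[OF elem_mat_carrier n] using n
    by (intro eq_matI) (auto simp: elem_mat_def)
  then show ?thesis
    using phi_mult[OF elem_mat_carrier elem_mat_carrier, of 0 0 0 0] by metis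
qed

text \<open>An idempotent fixes each of its columns, and by injectivity of \<open>\<phi>\<close>
  this one is not the zero matrix, so one of its nonzero columns serves.\<close>

lemma exists_fixed_vec:
  obtains a where "a \<in> carrier_vec n" "\<phi> (elem_mat n 0 0) *\<^sub>v a = a" "a \<noteq> 0\<^sub>v n"
proof -
  let ?P = "\<phi> (elem_mat n 0 0)"
  have P: "?P \<in> carrier_mat n n" by simp
  have "elem_mat n 0 0 $$ (0, 0) \<noteq> (0\<^sub>m n n :: 'a mat) $$ (0, 0)"
    using n by (simp add: elem_mat_def)
  then have "elem_mat n 0 0 \<noteq> (0\<^sub>m n n :: 'a mat)" by metis
  then have "?P \<noteq> 0\<^sub>m n n"
    using phi_inj[of "elem_mat n 0 0" "0\<^sub>m n n"] by (auto simp: phi_zero)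
  then obtain i j where ij: "i < n" "j < n" "?P $$ (i, j) \<noteq> 0"
    using P by (metis carrier_matD eq_matI index_zero_mat)
  let ?a = "?P *\<^sub>v unit_vec n j"
  show thesis
  proof (rule that)
    show "?a \<in> carrier_vec n"
      using P by (rule mult_mat_vec_carrier) simp
    show "?P *\<^sub>v ?a = ?a"
      using assoc_mult_mat_vec[OF P P, of "unit_vec n j"] by (simp add: phi_elem_idem)
    show "?a \<noteq> 0\<^sub>v n"
    proof
      assume "?a = 0\<^sub>v n"
      then have "?a $ i = 0" using ij(1) by simp
      then show False using P ij by simp
    qed
  qed
qed

section \<open>The matrix \<open>A_bar n \<phi> a\<close> of a fixed vector \<open>a\<close>\<close>

context
  fixes a :: "'a vec"
  assumes a: "a \<in> carrier_vec n" and fixed: "\<phi> (elem_mat n 0 0) *\<^sub>v a = a"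
begin

lemma A_bar_carrier [simp]: "A_bar n \<phi> a \<in> carrier_mat n n"
  by (simp add: A_bar_def mat_of_cols_def)

lemma A_bar_index:
  assumes "i < n" "k < n"
  shows "A_bar n \<phi> a $$ (i, k) = (\<phi> (elem_mat n 0 k) *\<^sub>v a) $ i"
  \<comment> \<open>For \<open>k < n\<close> the index \<open>n - Suc (n - Suc k)\<close> is
    \<open>k\<close>.\<close>
  using assms phi_shift_power_mult_phi_elem[of "n - Suc k"]
  by (simp add: A_bar_def mat_of_cols_index)

text \<open>These matrices form the right ideal generated by \<open>elem_mat n 0 0\<close>;
  \<open>\<phi>\<close> carries it to the left ideal generated by the idempotent that fixes
  \<open>a\<close>.\<close>

definition first_row_mat :: "'a vec \<Rightarrow> 'a mat" where
  "first_row_mat w = mat n n (\<lambda>(r, c). if r = 0 then w $ c else 0)"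

lemma first_row_mat_carrier [simp]: "first_row_mat w \<in> carrier_mat n n"
  by (simp add: first_row_mat_def)

text \<open>Expand \<open>first_row_mat w\<close> in the units \<open>elem_mat n 0 k\<close>: by
  \<open>phi_smult\<close> the coefficient \<open>w $ k\<close> comes out as
  \<open>induced_hom (w $ k)\<close>, and the units produce the columns of
  \<open>A_bar n \<phi> a\<close>.\<close>

lemma A_bar_mult_map_vec:
  assumes w: "w \<in> carrier_vec n"
  shows "A_bar n \<phi> a *\<^sub>v map_vec induced_hom w = \<phi> (first_row_mat w) *\<^sub>v a"
proof (rule eq_vecI)
  fix i assume "i < dim_vec (\<phi> (first_row_mat w) *\<^sub>v a)"
  then have i: "i < n" by simp
  \<comment> \<open>\<open>P m\<close> keeps the first \<open>m\<close> entries of \<open>w\<close>.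
    The expansion grows by one unit per induction step, so additivity for two summands is
    enough.\<close>
  define P where "P m = mat n n (\<lambda>(r, c). if r = 0 \<and> c < m then w $ c else 0)" for m
  have P: "P m \<in> carrier_mat n n" for m by (simp add: P_def)
  have "(\<phi> (P m) *\<^sub>v a) $ i = (\<Sum>j<m. A_bar n \<phi> a $$ (i, j) * induced_hom (w $ j))"
    if "m \<le> n" for m
    using that
  proof (induction m)
    case 0
    have "P 0 = 0\<^sub>m n n" by (auto simp: P_def intro!: eq_matI)
    then show ?case using a i by (simp add: phi_zero)
  next
    case (Suc m)
    have "P (Suc m) = P m + w $ m \<cdot>\<^sub>m elem_mat n 0 m"
      by (rule eq_matI) (auto simp: P_def elem_mat_def less_Suc_eq)
    then have "\<phi> (P (Suc m)) = \<phi> (P m) + induced_hom (w $ m) \<cdot>\<^sub>m \<phi> (elem_mat n 0 m)"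
      using P by (simp add: phi_add phi_smult)
    moreover have "\<phi> (P m) \<in> carrier_mat n n" "\<phi> (elem_mat n 0 m) \<in> carrier_mat n n"
      using P by auto
    ultimately show ?case
      using Suc a i by (simp add: add_mult_distrib_mat_vec[of _ n n]
          smult_mat_mult_vec[of _ n n] A_bar_index)
  qed
  from this[of n] have "(\<phi> (P n) *\<^sub>v a) $ i
      = (\<Sum>j<n. A_bar n \<phi> a $$ (i, j) * induced_hom (w $ j))" by simp
  moreover have "P n = first_row_mat w"
    by (auto simp: P_def first_row_mat_def intro!: eq_matI)
  moreover have "(A_bar n \<phi> a *\<^sub>v map_vec induced_hom w) $ i
      = (\<Sum>j<n. A_bar n \<phi> a $$ (i, j) * induced_hom (w $ j))"
    using w i carrier_matD[OF A_bar_carrier]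
    by (auto simp: scalar_prod_def atLeast0LessThan intro!: sum.cong)
  ultimately show "(A_bar n \<phi> a *\<^sub>v map_vec induced_hom w) $ i = (\<phi> (first_row_mat w) *\<^sub>v a) $ i"
    by simp
next
  show "dim_vec (A_bar n \<phi> a *\<^sub>v map_vec induced_hom w) = dim_vec (\<phi> (first_row_mat w) *\<^sub>v a)"
    using carrier_matD[OF A_bar_carrier] by simp
qed

text \<open>This allows \<open>A_bar n \<phi> a\<close> to be evaluated on arbitrary vectors through
  \<open>A_bar_mult_map_vec\<close>.\<close>

lemma map_vec_induced_hom_surj:
  assumes "v \<in> carrier_vec n"
  obtains w where "w \<in> carrier_vec n" "map_vec induced_hom w = v"
proof -
  interpret field_isom induced_hom by (rule field_isom_induced_hom)
  obtain g where "\<And>y. induced_hom (g y) = y"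
    using surj surjD by metis
  then have "map_vec induced_hom (map_vec g v) = v"
    by (intro eq_vecI) auto
  then show thesis
    using that[of "map_vec g v"] assms by simp
qed

text \<open>For \<open>v = map_vec induced_hom w\<close> in the kernel,
  \<open>\<phi> (first_row_mat w)\<close> kills \<open>a\<close>. Applying
  \<open>\<phi> (elem_mat n k 0)\<close> isolates one entry: \<open>v $ k\<close> times
  \<open>a\<close> is zero.\<close>

lemma A_bar_trivial_kernel:
  assumes nz: "a \<noteq> 0\<^sub>v n" and v: "v \<in> carrier_vec n" and zero: "A_bar n \<phi> a *\<^sub>v v = 0\<^sub>v n"
  shows "v = 0\<^sub>v n"
proof -
  interpret field_isom induced_hom by (rule field_isom_induced_hom)
  obtain w where w: "w \<in> carrier_vec n" "map_vec induced_hom w = v"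
    using map_vec_induced_hom_surj[OF v] .
  have "v $ k = 0" if k: "k < n" for k
  proof -
    have "first_row_mat w * elem_mat n k 0 = w $ k \<cdot>\<^sub>m elem_mat n 0 0"
      unfolding mult_elem_mat[OF first_row_mat_carrier k] using n k
      by (intro eq_matI) (auto simp: first_row_mat_def elem_mat_def)
    then have "\<phi> (elem_mat n k 0) * \<phi> (first_row_mat w) = induced_hom (w $ k) \<cdot>\<^sub>m \<phi> (elem_mat n 0 0)"
      using phi_mult[OF first_row_mat_carrier elem_mat_carrier, of w k 0] by (simp add: phi_smult)
    then have "\<phi> (elem_mat n k 0) *\<^sub>v (\<phi> (first_row_mat w) *\<^sub>v a)
        = (induced_hom (w $ k) \<cdot>\<^sub>m \<phi> (elem_mat n 0 0)) *\<^sub>v a"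
      using assoc_mult_mat_vec[of "\<phi> (elem_mat n k 0)" n n "\<phi> (first_row_mat w)" n a] a by simp
    moreover have "\<phi> (first_row_mat w) *\<^sub>v a = 0\<^sub>v n"
      using zero w A_bar_mult_map_vec by metis
    moreover have "\<phi> (elem_mat n k 0) *\<^sub>v 0\<^sub>v n = 0\<^sub>v n"
      by (intro eq_vecI) auto
    ultimately have "induced_hom (w $ k) \<cdot>\<^sub>v a = 0\<^sub>v n"
      using a fixed
      by (simp add: smult_mat_mult_vec[of _ n n])
    \<comment> \<open>A nonzero entry of \<open>a\<close> cancels, leaving
      \<open>induced_hom (w $ k) = 0\<close>, and this value is \<open>v $ k\<close> itself.\<close>
    moreover obtain i where "i < n" "a $ i \<noteq> 0"
      using a nz by (metis carrier_vecD eq_vecI index_zero_vec)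
    ultimately show ?thesis
      using a w k by (metis carrier_vecD index_map_vec(1) index_smult_vec(1) index_zero_vec(1)
          mult_eq_0_iff)
  qed
  then show ?thesis
    using v by (intro eq_vecI) auto
qed

text \<open>Both sides are tested on the vectors \<open>map_vec induced_hom w\<close>, which are all
  vectors. The reversal turns the left action of \<open>\<phi> X\<close> into right multiplication
  of \<open>first_row_mat w\<close> by \<open>X\<close>; this is the source of the
  transpose.\<close>

lemma phi_mult_A_bar:
  assumes X: "X \<in> carrier_mat n n"
  shows "\<phi> X * A_bar n \<phi> a = A_bar n \<phi> a * transpose_mat (map_mat induced_hom X)"
proof (rule mat_eqI_mult_vec[where nr = n and nc = n])
  interpret field_isom induced_hom by (rule field_isom_induced_hom)
  fix v :: "'a vec" assume v: "v \<in> carrier_vec n"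
  obtain w where w: "w \<in> carrier_vec n" "map_vec induced_hom w = v"
    using map_vec_induced_hom_surj[OF v] .
  have row: "first_row_mat w * X = first_row_mat (transpose_mat X *\<^sub>v w)"
    using X w n by (auto intro!: eq_matI sum.cong
        simp: first_row_mat_def scalar_prod_def atLeast0LessThan mult.commute)
  have "(\<phi> X * A_bar n \<phi> a) *\<^sub>v v = \<phi> X *\<^sub>v (\<phi> (first_row_mat w) *\<^sub>v a)"
    using X v w(2) A_bar_mult_map_vec[OF w(1)] by (simp add: assoc_mult_mat_vec[of _ n n _ n])
  also have "\<dots> = \<phi> (first_row_mat w * X) *\<^sub>v a"
    using X a by (simp add: phi_mult assoc_mult_mat_vec[of _ n n _ n])
  also have "\<dots> = A_bar n \<phi> a *\<^sub>v map_vec induced_hom (transpose_mat X *\<^sub>v w)"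
    using X w by (simp add: row A_bar_mult_map_vec)
  \<comment> \<open>Being a ring homomorphism, \<open>induced_hom\<close> passes through the sums
    and products onto the entries of \<open>X\<close> and \<open>w\<close>.\<close>
  also have "map_vec induced_hom (transpose_mat X *\<^sub>v w) = transpose_mat (map_mat induced_hom X) *\<^sub>v v"
    using X w by (auto intro!: eq_vecI simp: scalar_prod_def hom_sum hom_mult)
  also have "A_bar n \<phi> a *\<^sub>v (transpose_mat (map_mat induced_hom X) *\<^sub>v v)
      = (A_bar n \<phi> a * transpose_mat (map_mat induced_hom X)) *\<^sub>v v"
    using X v by (simp add: assoc_mult_mat_vec[of _ n n _ n])
  finally show "(\<phi> X * A_bar n \<phi> a) *\<^sub>v v
      = (A_bar n \<phi> a * transpose_mat (map_mat induced_hom X)) *\<^sub>v v" .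
qed (use X phi_carrier[OF X] A_bar_carrier in \<open>auto intro!: mult_carrier_mat\<close>)

end

end

theorem theorem4p3:
  fixes n :: nat and \<phi> :: "'a::field mat \<Rightarrow> 'a mat"
  assumes "n \<ge> 1"
    and "ring_anti_automorphism n \<phi>"
  shows "\<exists>f :: 'a \<Rightarrow> 'a. field_isom f \<and>
    (let N = mat_kernel (1\<^sub>m n - \<phi> (transpose_mat (shift_mat n)) ^\<^sub>m (n - 1) * \<phi> (elem_mat n 0 (n - 1)))
     in (\<exists>a \<in> N. a \<noteq> 0\<^sub>v n) \<and>
        (\<forall>a \<in> N. a \<noteq> 0\<^sub>v n \<longrightarrow>
           invertible_mat (A_bar n \<phi> a) \<and>
           (\<forall>X \<in> carrier_mat n n.
              \<phi> X = A_bar n \<phi> a * transpose_mat (map_mat f X) * the (mat_inverse (A_bar n \<phi> a)))))"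
proof -
  have n: "0 < n" using assms(1) by simp
  note anti = assms(2)
  \<comment> \<open>This witness is independent of \<open>a\<close>, so one automorphism serves all
    kernel vectors.\<close>
  let ?f = "induced_hom n \<phi>"
  \<comment> \<open>Stated for fixed vectors; \<open>kernel_iff_fixed\<close> translates to the
    kernel at the end.\<close>
  have "invertible_mat (A_bar n \<phi> a) \<and> (\<forall>X \<in> carrier_mat n n.
      \<phi> X = A_bar n \<phi> a * transpose_mat (map_mat ?f X) * the (mat_inverse (A_bar n \<phi> a)))"
    if a: "a \<in> carrier_vec n" "\<phi> (elem_mat n 0 0) *\<^sub>v a = a" "a \<noteq> 0\<^sub>v n" for a
  proof -
    let ?A = "A_bar n \<phi> a"
    have A: "?A \<in> carrier_mat n n" by (rule A_bar_carrier[OF n anti a(1,2)])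
    obtain B where B: "mat_inverse ?A = Some B" "B \<in> carrier_mat n n" "?A * B = 1\<^sub>m n" "B * ?A = 1\<^sub>m n"
      using trivial_kernel_imp_mat_inverse[OF A] A_bar_trivial_kernel[OF n anti a] by metis
    have "invertible_mat ?A"
      using A B unfolding invertible_mat_def inverts_mat_def by auto
    moreover have "\<phi> X = ?A * transpose_mat (map_mat ?f X) * B" if X: "X \<in> carrier_mat n n" for X
    proof -
      have c: "\<phi> X \<in> carrier_mat n n" by (rule phi_carrier[OF n anti X])
      \<comment> \<open>Inserting \<open>?A * B = 1\<^sub>m n\<close> creates the product that
        \<open>phi_mult_A_bar\<close> rewrites.\<close>
      then have "\<phi> X = \<phi> X * ?A * B"
        using A B by (simp add: assoc_mult_mat[of _ n n _ n _ n])
      then show ?thesis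
        by (simp add: phi_mult_A_bar[OF n anti a(1,2) X])
    qed
    ultimately show ?thesis
      using B by simp
  qed
  moreover obtain a where "a \<in> carrier_vec n" "\<phi> (elem_mat n 0 0) *\<^sub>v a = a" "a \<noteq> 0\<^sub>v n"
    using exists_fixed_vec[OF n anti] .
  ultimately show ?thesis
    unfolding Let_def using field_isom_induced_hom[OF n anti] kernel_iff_fixed[OF n anti] by blast
qed

end
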